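(* Let $\mathcal{H}$ be a real separable Hilbert space and let $T$ be a positive invertible operator on $\mathcal{H}\oplus\mathcal{H}$ that belongs to Class $\mathbb{A}$ or Class $\mathbb{B}$, that is, $T$ has one of the following forms: (Class $\mathbb{A}$) $T=\begin{bmatrix} A & 0 \\ 0 & B \end{bmatrix}$, where $A,B$ are positive invertible operators on $\mathcal{H}$ with $AB=BA$; (Class $\mathbb{B}$) $T=\begin{bmatrix} A & B \\ B & A \end{bmatrix}$, where $A,B$ are self-adjoint operators on $\mathcal{H}$ such that $A+B$ and $A-B$ are positive invertible and commute with each other. Let $m=\inf\sigma(T)$ and $M=\sup\sigma(T)$. Then $\sigma_{sy}(T)\subset[m,M]$.
   Context: Operators are bounded and linear. The spectrum of an operator on a real Hilbert space is that of its complexification. An operator on a real Hilbert space is (strictly) positive invertible if it is self-adjoint and its spectrum is contained in $(0,\infty)$. On $\mathcal{H}\oplus\mathcal{H}$ let $J=\begin{bmatrix} 0 & I \\ -I & 0 \end{bmatrix}$. A bounded invertible operator $Q$ on $\mathcal{H}\oplus\mathcal{H}$ is symplectic if $Q^TJQ=J$. Symplectic spectrum (infinite-dimensional Williamson normal form): for a strictly positive invertible operator $T$ on $\mathcal{H}\oplus\mathcal{H}$ there are a positive invertible operator $D$ on $\mathcal{H}$ and a symplectic $Q$ on $\mathcal{H}\oplus\mathcal{H}$ with $T=Q^T\begin{bmatrix} D & 0 \\ 0 & D \end{bmatrix}Q$, and $D$ is unique up to conjugation by an orthogonal transformation; the symplectic spectrum is $\sigma_{sy}(T):=\sigma(D)$.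 *)

theory Defs
  imports "HOL-Analysis.Analysis"
begin

definition invertible_op ::
    "('a::real_normed_vector \<Rightarrow>\<^sub>L 'a) \<Rightarrow> bool" where
  "invertible_op A \<longleftrightarrow> (\<exists>R. R o\<^sub>L A = id_blinfun \<and> A o\<^sub>L R = id_blinfun)"

(* The adjoint (for real spaces, the transpose).  On a Hilbert space the library's
   adjoint of a bounded operator exists (Riesz) and is bounded, so that Blinfun is
   applied to a bounded linear map. *)
definition adj_op ::
    "('a::real_inner \<Rightarrow>\<^sub>L 'b::real_inner) \<Rightarrow> ('b \<Rightarrow>\<^sub>L 'a)" where
  "adj_op A = Blinfun (adjoint (blinfun_apply A))"

definition selfadjoint_op :: "('a::real_inner \<Rightarrow>\<^sub>L 'a) \<Rightarrow> bool" where
  "selfadjoint_op A \<longleftrightarrow> (\<forall>x y. blinfun_apply A x \<bullet> y = x \<bullet> blinfun_apply A y)"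

(* The direct sum of two Hilbert spaces is the product type; its inner product in the
   library is the sum of the componentwise inner products.  block_op A B C D is the
   operator with rows (A, B) and (C, D). *)
lift_definition block_op ::
    "('a::real_normed_vector \<Rightarrow>\<^sub>L 'c::real_normed_vector) \<Rightarrow>
     ('b::real_normed_vector \<Rightarrow>\<^sub>L 'c) \<Rightarrow>
     ('a \<Rightarrow>\<^sub>L 'd::real_normed_vector) \<Rightarrow> ('b \<Rightarrow>\<^sub>L 'd) \<Rightarrow> ('a \<times> 'b) \<Rightarrow>\<^sub>L ('c \<times> 'd)"
  is "\<lambda>A B C D p. (A (fst p) + B (snd p), C (fst p) + D (snd p))"
  by (intro bounded_linear_Pair bounded_linear_add)
     (auto intro: bounded_linear_compose bounded_linear_fst bounded_linear_snd)

(* The complexification of H is H x H, where (x, y) stands for x + iy; complex_scalar z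
   is multiplication by the complex number z, and complexify A maps x + iy to Ax + i(Ay). *)
definition complex_scalar ::
    "complex \<Rightarrow> ('a::real_normed_vector \<times> 'a) \<Rightarrow>\<^sub>L ('a \<times> 'a)" where
  "complex_scalar z =
     block_op (Re z *\<^sub>R id_blinfun) (- Im z *\<^sub>R id_blinfun)
              (Im z *\<^sub>R id_blinfun) (Re z *\<^sub>R id_blinfun)"

definition complexify ::
    "('a::real_normed_vector \<Rightarrow>\<^sub>L 'a) \<Rightarrow> ('a \<times> 'a) \<Rightarrow>\<^sub>L ('a \<times> 'a)" where
  "complexify A = block_op A 0 0 A"

definition complex_linear_op ::
    "(('a::real_normed_vector \<times> 'a) \<Rightarrow>\<^sub>L ('a \<times> 'a)) \<Rightarrow> bool" where
  "complex_linear_op R \<longleftrightarrow> (\<forall>z. R o\<^sub>L complex_scalar z = complex_scalar z o\<^sub>L R)"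

definition op_spectrum :: "('a::real_normed_vector \<Rightarrow>\<^sub>L 'a) \<Rightarrow> complex set" where
  "op_spectrum A = {z. \<not> (\<exists>R. complex_linear_op R \<and>
       R o\<^sub>L (complexify A - complex_scalar z) = id_blinfun \<and>
       (complexify A - complex_scalar z) o\<^sub>L R = id_blinfun)}"

definition positive_invertible :: "('a::real_inner \<Rightarrow>\<^sub>L 'a) \<Rightarrow> bool" where
  "positive_invertible A \<longleftrightarrow>
     selfadjoint_op A \<and> op_spectrum A \<subseteq> complex_of_real ` {0<..}"

definition sympl_J :: "('a::real_inner \<times> 'a) \<Rightarrow>\<^sub>L ('a \<times> 'a)" where
  "sympl_J = block_op 0 id_blinfun (- id_blinfun) 0"

definition symplectic :: "(('a::real_inner \<times> 'a) \<Rightarrow>\<^sub>L ('a \<times> 'a)) \<Rightarrow> bool" where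
  "symplectic Q \<longleftrightarrow> invertible_op Q \<and> adj_op Q o\<^sub>L sympl_J o\<^sub>L Q = sympl_J"

definition williamson_form ::
    "(('a::real_inner \<times> 'a) \<Rightarrow>\<^sub>L ('a \<times> 'a)) \<Rightarrow> ('a \<Rightarrow>\<^sub>L 'a) \<Rightarrow> bool" where
  "williamson_form T D \<longleftrightarrow> positive_invertible D \<and>
     (\<exists>Q. symplectic Q \<and> T = adj_op Q o\<^sub>L block_op D 0 0 D o\<^sub>L Q)"

(* D is only determined up to orthogonal conjugation, which does not change its spectrum,
   so the choice of D is immaterial. *)
definition symplectic_spectrum ::
    "(('a::real_inner \<times> 'a) \<Rightarrow>\<^sub>L ('a \<times> 'a)) \<Rightarrow> complex set" where
  "symplectic_spectrum T = op_spectrum (SOME D. williamson_form T D)"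

definition class_A :: "(('a::real_inner \<times> 'a) \<Rightarrow>\<^sub>L ('a \<times> 'a)) \<Rightarrow> bool" where
  "class_A T \<longleftrightarrow> (\<exists>A B. positive_invertible A \<and> positive_invertible B \<and>
     A o\<^sub>L B = B o\<^sub>L A \<and> T = block_op A 0 0 B)"

definition class_B :: "(('a::real_inner \<times> 'a) \<Rightarrow>\<^sub>L ('a \<times> 'a)) \<Rightarrow> bool" where
  "class_B T \<longleftrightarrow> (\<exists>A B. selfadjoint_op A \<and> selfadjoint_op B \<and>
     positive_invertible (A + B) \<and> positive_invertible (A - B) \<and>
     (A + B) o\<^sub>L (A - B) = (A - B) o\<^sub>L (A + B) \<and> T = block_op A B B A)"

end

theory Submission
  imports Defs
begin

text \<open>If \<open>T = Q\<^sup>T (D \<oplus> D) Q\<close> with \<open>Q\<close> symplectic, then \<open>J\<^sup>-\<^sup>1 T\<close> is similar to \<open>J\<^sup>-\<^sup>1 (D \<oplus> D)\<close>. Hence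
  \<open>l\<close> in the spectrum of \<open>D\<close> yields approximate solutions of \<open>T v = l U v\<close> with an isometry
  \<open>U\<close>, and \<open>m |v| \<le> |T v| \<le> M |v|\<close> forces \<open>m \<le> l \<le> M\<close>. The structure
  of \<open>T\<close> provides a Williamson form, without which \<open>SOME D\<close> in the symplectic spectrum would be
  arbitrary: in class A it is written down with fourth roots of the blocks, and class B is
  reduced to class A by a rotation.\<close>

subsection \<open>Coercive operators and square roots\<close>

text \<open>This serves \<open>sqrt_op\<close>, where a closed set of operators has to be complete.
  A Cauchy sequence converges pointwise, and its Cauchy estimate is uniform relative to
  \<open>norm x\<close>, so it passes to the limit in operator norm.\<close>

lemma complete_UNIV_blinfun:
  "complete (UNIV :: ('a::real_normed_vector \<Rightarrow>\<^sub>L 'b::{real_normed_vector, complete_space}) set)"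
proof (rule completeI)
  fix X :: "nat \<Rightarrow> 'a \<Rightarrow>\<^sub>L 'b"
  assume X: "Cauchy X"
  have close: "\<exists>N. \<forall>m\<ge>N. \<forall>n\<ge>N. \<forall>x. norm (X m x - X n x) \<le> e * norm x" if "e > 0" for e
  proof -
    obtain N where N: "\<And>m n. m \<ge> N \<Longrightarrow> n \<ge> N \<Longrightarrow> norm (X m - X n) < e"
      using CauchyD[OF X \<open>e > 0\<close>] by blast
    have "norm (X m x - X n x) \<le> e * norm x" if "m \<ge> N" "n \<ge> N" for m n x
      using norm_blinfun[of "X m - X n" x] mult_right_mono[OF less_imp_le[OF N[OF that]], of "norm x"]
      by (simp add: blinfun.diff_left)
    then show ?thesis by blast
  qed
  have "Cauchy (\<lambda>n. X n x)" for x
  proof (rule CauchyI)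
    fix e :: real assume "e > 0"
    define d where "d = e / (norm x + 1)"
    have np: "norm x + 1 > 0" by (simp add: add_nonneg_pos)
    have d: "d > 0" using \<open>e > 0\<close> np by (simp add: d_def)
    have "d * norm x < d * (norm x + 1)" using d by simp
    also have "\<dots> = e" using np by (simp add: d_def)
    finally have "d * norm x < e" .
    then show "\<exists>N. \<forall>m\<ge>N. \<forall>n\<ge>N. norm (X m x - X n x) < e"
      using close[OF d] by (meson order_le_less_trans)
  qed
  then have "\<exists>l. (\<lambda>n. X n x) \<longlonglongrightarrow> l" for x
    by (metis Cauchy_convergent convergent_def)
  then obtain v where v: "\<And>x. (\<lambda>n. X n x) \<longlonglongrightarrow> v x"
    by metis
  obtain K where K: "\<And>n. norm (X n) \<le> K"
    using cauchy_imp_bounded[OF X] unfolding bounded_iff by blast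
  have "bounded_linear v"
  proof (rule bounded_linear_intro)
    show "v (x + y) = v x + v y" for x y
      using LIMSEQ_unique[OF v[of "x + y"]] tendsto_add[OF v[of x] v[of y]]
      by (simp add: blinfun.add_right)
    show "v (r *\<^sub>R x) = r *\<^sub>R v x" for r x
      using LIMSEQ_unique[OF v[of "r *\<^sub>R x"]] tendsto_scaleR[OF tendsto_const[of r] v[of x]]
      by (simp add: blinfun.scaleR_right)
    show "norm (v x) \<le> norm x * K" for x
    proof (rule Lim_norm_ubound[OF _ v])
      show "\<forall>\<^sub>F n in sequentially. norm (X n x) \<le> norm x * K"
        using order_trans[OF norm_blinfun mult_right_mono[OF K norm_ge_zero]]
        by (simp add: mult.commute)
    qed simp
  qed
  then obtain V where V: "blinfun_apply V = v"
    by (metis bounded_linear_Blinfun_apply)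
  have "X \<longlonglongrightarrow> V"
  proof (rule LIMSEQ_I)
    fix e :: real assume e: "e > 0"
    obtain N where N: "\<And>m n x. m \<ge> N \<Longrightarrow> n \<ge> N \<Longrightarrow> norm (X m x - X n x) \<le> e / 2 * norm x"
      using close[of "e / 2"] e by auto
    \<comment> \<open>Letting the second index tend to infinity leaves a weak inequality; starting
      from \<open>e / 2\<close> restores a strict one.\<close>
    have "norm (X m - V) \<le> e / 2" if "m \<ge> N" for m
    proof (rule norm_blinfun_bound)
      fix x
      have "norm (X m x - v x) \<le> e / 2 * norm x"
        by (rule Lim_norm_ubound[OF _ tendsto_diff[OF tendsto_const v]])
           (use N[OF that] in \<open>auto simp: eventually_sequentially\<close>)
      then show "norm ((X m - V) x) \<le> e / 2 * norm x"
        by (simp add: blinfun.diff_left V)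
    qed (use e in simp)
    then show "\<exists>N. \<forall>m\<ge>N. norm (X m - V) < e"
      using e by (metis field_sum_of_halves less_add_same_cancel1 half_gt_zero order_le_less_trans)
  qed
  then show "\<exists>l\<in>UNIV. X \<longlonglongrightarrow> l" by blast
qed

text \<open>For self-adjoint operators on a complete space this replaces the spectral condition of
  \<open>positive_invertible\<close>; see \<open>positive_invertible_iff\<close>.\<close>

definition coercive_op :: "('a::real_inner \<Rightarrow>\<^sub>L 'a) \<Rightarrow> bool" where
  "coercive_op A \<longleftrightarrow> (\<exists>c>0. \<forall>x. c * (norm x)\<^sup>2 \<le> A x \<bullet> x)"

text \<open>For a coercivity constant \<open>c\<close> and a norm bound \<open>K\<close>, the square
  of the norm is at most \<open>1 - 2 * t * c + t^2 * K^2\<close>. The choice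
  \<open>t = c / K^2\<close> minimises this and leaves \<open>1 - c^2 / K^2\<close>.\<close>

lemma coercive_op_contraction:
  fixes A :: "'a::real_inner \<Rightarrow>\<^sub>L 'a"
  assumes "coercive_op A"
  obtains t q where "t > 0" "0 \<le> q" "q < 1" "norm (id_blinfun - t *\<^sub>R A) \<le> q"
proof -
  obtain c where c: "c > 0" "\<And>x. c * (norm x)\<^sup>2 \<le> A x \<bullet> x"
    using assms by (auto simp: coercive_op_def)
  \<comment> \<open>The maximum keeps \<open>K\<close> positive on the trivial space and ensures
    that the radicand of \<open>q\<close> is nonnegative.\<close>
  define K where "K = max (norm A) c"
  have K: "K > 0" "K \<ge> c" using c by (auto simp: K_def)
  define t where "t = c / K\<^sup>2"
  define q where "q = sqrt (1 - c\<^sup>2 / K\<^sup>2)"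
  have le1: "c\<^sup>2 / K\<^sup>2 \<le> 1" using K c by (simp add: power_mono)
  have t: "t > 0" using c K by (simp add: t_def)
  have q: "q \<ge> 0" "q < 1" using le1 c K by (auto simp: q_def)
  have "norm ((id_blinfun - t *\<^sub>R A) x) \<le> q * norm x" for x
  proof (rule power2_le_imp_le)
    have "norm (A x) \<le> K * norm x"
      using norm_blinfun[of A x] mult_right_mono[of "norm A" K "norm x"] by (simp add: K_def)
    then have "(norm (A x))\<^sup>2 \<le> K\<^sup>2 * (norm x)\<^sup>2"
      by (metis norm_ge_zero power_mono power_mult_distrib)
    then have 1: "t\<^sup>2 * (norm (A x))\<^sup>2 \<le> t\<^sup>2 * (K\<^sup>2 * (norm x)\<^sup>2)"
      by (rule mult_left_mono) simp
    have 2: "t * (c * (norm x)\<^sup>2) \<le> t * (A x \<bullet> x)"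
      using c t by simp
    have "(norm ((id_blinfun - t *\<^sub>R A) x))\<^sup>2
        = (norm x)\<^sup>2 - 2 * (t * (A x \<bullet> x)) + t\<^sup>2 * (norm (A x))\<^sup>2"
      unfolding power2_norm_eq_inner power2_eq_square[of t]
      by (simp add: blinfun.diff_left blinfun.scaleR_left inner_commute algebra_simps)
    also have "\<dots> \<le> (norm x)\<^sup>2 - 2 * (t * (c * (norm x)\<^sup>2)) + t\<^sup>2 * (K\<^sup>2 * (norm x)\<^sup>2)"
      using 1 2 by linarith
    also have "\<dots> = (1 - c\<^sup>2 / K\<^sup>2) * (norm x)\<^sup>2"
      using K by (simp add: t_def field_simps power2_eq_square)
    also have "\<dots> = (q * norm x)\<^sup>2"
      using le1 by (simp add: q_def power_mult_distrib)
    finally show "(norm ((id_blinfun - t *\<^sub>R A) x))\<^sup>2 \<le> (q * norm x)\<^sup>2" .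
  qed (use q in simp)
  then have "norm (id_blinfun - t *\<^sub>R A) \<le> q"
    using q by (intro norm_blinfun_bound) auto
  with t q that show thesis by blast
qed

lemma coercive_op_lower_bound:
  assumes "coercive_op A"
  obtains c where "c > 0" "\<And>x. c * norm x \<le> norm (A x)"
proof -
  obtain c where c: "c > 0" "\<And>x. c * (norm x)\<^sup>2 \<le> A x \<bullet> x"
    using assms by (auto simp: coercive_op_def)
  have "c * norm x \<le> norm (A x)" for x
  proof (cases "x = 0")
    case False
    have "(c * norm x) * norm x \<le> norm (A x) * norm x"
      using c(2)[of x] norm_cauchy_schwarz[of "A x" x] by (simp add: power2_eq_square mult.assoc)
    then show ?thesis using False by simp
  qed simp
  with c(1) that show thesis by blast
qed

text \<open>Lax-Milgram: solutions of \<open>A x = y\<close> are the fixed points of the contraction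
  sending \<open>x\<close> to \<open>x - t A x + t y\<close>. The lower norm bound yields
  injectivity and a bounded inverse.\<close>

lemma coercive_op_invertible:
  fixes A :: "'a::{real_inner, complete_space} \<Rightarrow>\<^sub>L 'a"
  assumes "coercive_op A"
  obtains R where "R o\<^sub>L A = id_blinfun" "A o\<^sub>L R = id_blinfun"
proof -
  obtain t q where tq: "t > 0" "0 \<le> q" "q < 1" "norm (id_blinfun - t *\<^sub>R A) \<le> q"
    using coercive_op_contraction[OF assms] .
  obtain c where c: "c > 0" and lower: "\<And>x. c * norm x \<le> norm (A x)"
    using coercive_op_lower_bound[OF assms] by blast
  have surj: "\<exists>x. A x = y" for y
  proof -
    define f where "f x = (id_blinfun - t *\<^sub>R A) x + t *\<^sub>R y" for x
    have "dist (f u) (f v) \<le> q * dist u v" for u v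
    proof -
      have "dist (f u) (f v) = norm ((id_blinfun - t *\<^sub>R A) (u - v))"
        by (simp add: f_def dist_norm blinfun.diff_right)
      also have "\<dots> \<le> norm (id_blinfun - t *\<^sub>R A) * norm (u - v)" by (rule norm_blinfun)
      also have "\<dots> \<le> q * dist u v" using tq by (simp add: dist_norm mult_right_mono)
      finally show ?thesis .
    qed
    then obtain x where "f x = x"
      using banach_fix_type[of q f] tq by blast
    then have "t *\<^sub>R A x = t *\<^sub>R y"
      by (simp add: f_def blinfun.diff_left blinfun.scaleR_left eq_commute[of "A x"] algebra_simps)
    then have "A x = y" using tq(1) by simp
    then show ?thesis by blast
  qed
  have inj: "u = v" if "A u = A v" for u v
    using lower[of "u - v"] that c by (simp add: blinfun.diff_right mult_le_0_iff)
  define g where "g y = (SOME x. A x = y)" for y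
  have Ag: "A (g y) = y" for y
    unfolding g_def using someI_ex[OF surj] .
  have "bounded_linear g"
  proof (rule bounded_linear_intro)
    show "g (x + y) = g x + g y" for x y
      by (rule inj) (simp add: Ag blinfun.add_right)
    show "g (r *\<^sub>R x) = r *\<^sub>R g x" for r x
      by (rule inj) (simp add: Ag blinfun.scaleR_right)
    show "norm (g x) \<le> norm x * inverse c" for x
      using lower[of "g x"] c by (simp add: Ag field_simps)
  qed
  then have G: "blinfun_apply (Blinfun g) = g" by (rule bounded_linear_Blinfun_apply)
  show thesis
  proof (rule that)
    show "A o\<^sub>L Blinfun g = id_blinfun" by (rule blinfun_eqI) (simp add: G Ag)
    show "Blinfun g o\<^sub>L A = id_blinfun" by (rule blinfun_eqI) (auto simp: G Ag intro: inj)
  qed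
qed

definition commuting_op :: "('a::real_normed_vector \<Rightarrow>\<^sub>L 'a) \<Rightarrow> ('a \<Rightarrow>\<^sub>L 'a) \<Rightarrow> bool" where
  "commuting_op A B \<longleftrightarrow> (\<forall>x. A (B x) = B (A x))"

text \<open>Writing \<open>t A = id - X\<close> with \<open>norm X < 1\<close>, a square root is \<open>id - Y\<close>
  with \<open>Y = (X + Y\<^sup>2) / 2\<close>. This is a contraction on a ball of radius below 1, and it preserves
  the closed set of self-adjoint operators in the bicommutant of \<open>A\<close>.\<close>

lemma sqrt_op:
  fixes A :: "'a::{real_inner, complete_space} \<Rightarrow>\<^sub>L 'a"
  assumes sa: "selfadjoint_op A" and co: "coercive_op A"
  obtains R where "selfadjoint_op R" "coercive_op R" "R o\<^sub>L R = A"
    "\<And>B. commuting_op B A \<Longrightarrow> commuting_op B R"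
proof -
  obtain t q where tq: "t > 0" "0 \<le> q" "q < 1" "norm (id_blinfun - t *\<^sub>R A) \<le> q"
    using coercive_op_contraction[OF co] .
  define X where "X = id_blinfun - t *\<^sub>R A"
  \<comment> \<open>The smaller root of \<open>r^2 - 2 r + q = 0\<close>: the ball of radius
    \<open>r\<close> is mapped into itself by \<open>F\<close>, and \<open>r < 1\<close> is also the
    Lipschitz constant there.\<close>
  define r where "r = 1 - sqrt (1 - q)"
  have r: "0 \<le> r" "r < 1" "(q + r * r) / 2 = r"
    using tq by (auto simp: r_def field_simps)
  define S where "S = {Y. norm Y \<le> r \<and> selfadjoint_op Y \<and> (\<forall>B. commuting_op B A \<longrightarrow> commuting_op B Y)}"
  define F where "F Y = (1/2) *\<^sub>R (X + (Y o\<^sub>L Y))" for Y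
  have lim: "(\<lambda>n. Z n x) \<longlonglongrightarrow> L x" if "Z \<longlonglongrightarrow> L" for Z :: "nat \<Rightarrow> 'a \<Rightarrow>\<^sub>L 'a" and L x
    using that by (intro tendsto_intros)
  have "closed S"
  proof (unfold closed_sequential_limits, intro allI impI)
    fix Z L assume "(\<forall>n. Z n \<in> S) \<and> Z \<longlonglongrightarrow> L"
    then have Z: "\<And>n. Z n \<in> S" and L: "Z \<longlonglongrightarrow> L" by auto
    have "norm L \<le> r"
      by (rule Lim_norm_ubound[OF _ L]) (use Z in \<open>auto simp: S_def\<close>)
    moreover have "L x \<bullet> y = x \<bullet> L y" for x y
    proof (rule LIMSEQ_unique)
      show "(\<lambda>n. Z n x \<bullet> y) \<longlonglongrightarrow> L x \<bullet> y" by (intro tendsto_intros lim[OF L])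
      show "(\<lambda>n. Z n x \<bullet> y) \<longlonglongrightarrow> x \<bullet> L y"
        using tendsto_inner[OF tendsto_const lim[OF L], of x y] Z
        by (simp add: S_def selfadjoint_op_def)
    qed
    moreover have "B (L x) = L (B x)" if "commuting_op B A" for B x
    proof (rule LIMSEQ_unique)
      show "(\<lambda>n. B (Z n x)) \<longlonglongrightarrow> B (L x)" by (intro tendsto_intros lim[OF L])
      show "(\<lambda>n. B (Z n x)) \<longlonglongrightarrow> L (B x)"
        using lim[OF L, of "B x"] Z that by (simp add: S_def commuting_op_def)
    qed
    ultimately show "L \<in> S" by (auto simp: S_def selfadjoint_op_def commuting_op_def)
  qed
  then have "complete S"
    by (rule complete_closed_subset[OF _ subset_UNIV complete_UNIV_blinfun])
  moreover have "0 \<in> S" using r by (auto simp: S_def selfadjoint_op_def commuting_op_def)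
  moreover have "F Y \<in> S" if "Y \<in> S" for Y
  proof -
    have Y: "norm Y \<le> r" "selfadjoint_op Y" "\<And>B. commuting_op B A \<Longrightarrow> commuting_op B Y"
      using that by (auto simp: S_def)
    have "norm (Y o\<^sub>L Y) \<le> r * r"
      using norm_blinfun_compose[of Y Y] mult_mono[OF Y(1) Y(1)] r by simp
    then have "norm (F Y) \<le> (q + r * r) / 2"
      using tq norm_triangle_ineq[of X "Y o\<^sub>L Y"] by (simp add: F_def X_def)
    moreover have "selfadjoint_op (F Y)"
      using Y(2) sa by (simp add: selfadjoint_op_def F_def X_def blinfun.bilinear_simps
          inner_add_left inner_add_right inner_diff_left inner_diff_right)
    moreover have "commuting_op B (F Y)" if "commuting_op B A" for B
      using that Y(3)[OF that]
      by (simp add: commuting_op_def F_def X_def blinfun.bilinear_simps)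
    ultimately show ?thesis using r by (simp add: S_def)
  qed
  moreover have "dist (F U) (F V) \<le> r * dist U V" if "U \<in> S" "V \<in> S" for U V
  proof -
    \<comment> \<open>This splitting of \<open>U^2 - V^2\<close> is valid for noncommuting
      \<open>U\<close> and \<open>V\<close>.\<close>
    have "F U - F V = (1/2) *\<^sub>R ((U o\<^sub>L (U - V)) + ((U - V) o\<^sub>L V))"
      by (rule blinfun_eqI) (simp add: F_def blinfun.bilinear_simps algebra_simps)
    then have "dist (F U) (F V) = norm ((U o\<^sub>L (U - V)) + ((U - V) o\<^sub>L V)) / 2"
      by (simp add: dist_norm)
    also have "\<dots> \<le> (norm U * norm (U - V) + norm (U - V) * norm V) / 2"
      using norm_triangle_ineq[of "U o\<^sub>L (U - V)" "(U - V) o\<^sub>L V"]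
        norm_blinfun_compose[of U "U - V"] norm_blinfun_compose[of "U - V" V] by simp
    also have "\<dots> \<le> (r * norm (U - V) + norm (U - V) * r) / 2"
      using that by (intro divide_right_mono add_mono mult_right_mono mult_left_mono)
        (auto simp: S_def)
    finally show ?thesis by (simp add: dist_norm)
  qed
  ultimately obtain Y where Y: "Y \<in> S" "F Y = Y"
    using Banach_fix[of S r F] r by blast
  have YS: "norm Y \<le> r" "selfadjoint_op Y" "\<And>B. commuting_op B A \<Longrightarrow> commuting_op B Y"
    using Y(1) by (auto simp: S_def)
  have YY: "Y (Y x) = 2 *\<^sub>R Y x - X x" for x
  proof -
    have "2 *\<^sub>R F Y x = X x + Y (Y x)"
      by (simp add: F_def blinfun.bilinear_simps)
    then show ?thesis by (simp add: Y(2))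
  qed
  \<comment> \<open>The fixed point equation gives \<open>(id - Y)^2 = id - X = t A\<close>, so the
    factor \<open>1 / sqrt t\<close> removes \<open>t\<close>. Coercivity follows from
    \<open>norm Y \<le> r < 1\<close>.\<close>
  define R where "R = (1 / sqrt t) *\<^sub>R (id_blinfun - Y)"
  show thesis
  proof (rule that[of R])
    show "selfadjoint_op R"
      using YS(2) by (simp add: selfadjoint_op_def R_def blinfun.bilinear_simps
          inner_diff_left inner_diff_right)
    show "commuting_op B R" if "commuting_op B A" for B
      using YS(3)[OF that] by (simp add: commuting_op_def R_def blinfun.bilinear_simps)
    show "R o\<^sub>L R = A"
    proof (rule blinfun_eqI)
      fix x
      have "(R o\<^sub>L R) x = (1 / t) *\<^sub>R (x - 2 *\<^sub>R Y x + Y (Y x))"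
        using tq by (simp add: R_def blinfun.bilinear_simps algebra_simps scaleR_2)
      also have "\<dots> = (1 / t) *\<^sub>R (t *\<^sub>R A x)"
        by (simp add: YY X_def blinfun.bilinear_simps)
      finally show "(R o\<^sub>L R) x = A x" using tq by simp
    qed
    have "(1 - r) / sqrt t * (norm x)\<^sup>2 \<le> R x \<bullet> x" for x
    proof -
      have "Y x \<bullet> x \<le> r * norm x * norm x"
        using norm_cauchy_schwarz[of "Y x" x] norm_blinfun[of Y x] YS(1)
        by (meson mult_right_mono norm_ge_zero order_trans)
      then have "(1 - r) * (norm x)\<^sup>2 \<le> (x - Y x) \<bullet> x"
        by (simp add: inner_diff_left dot_square_norm power2_eq_square algebra_simps)
      then have "(1 - r) * (norm x)\<^sup>2 / sqrt t \<le> (x - Y x) \<bullet> x / sqrt t"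
        using tq by (intro divide_right_mono) auto
      then show ?thesis
        by (simp add: R_def blinfun.bilinear_simps)
    qed
    then show "coercive_op R"
      using r tq unfolding coercive_op_def
      by (intro exI[of _ "(1 - r) / sqrt t"]) auto
  qed
qed

subsection \<open>Spectra of self-adjoint operators\<close>

lemma block_op_apply [simp]:
  "block_op A B C D p = (A (fst p) + B (snd p), C (fst p) + D (snd p))"
  by (simp add: block_op.rep_eq)

lemma complex_scalar_apply:
  "complex_scalar z p = (Re z *\<^sub>R fst p - Im z *\<^sub>R snd p, Im z *\<^sub>R fst p + Re z *\<^sub>R snd p)"
  by (simp add: complex_scalar_def blinfun.bilinear_simps)

lemma complexify_apply: "complexify A p = (A (fst p), A (snd p))"
  by (simp add: complexify_def)

text \<open>The resolvent at \<open>z = s + it\<close> is \<open>(A - s + it) P\<^sup>-\<^sup>1\<close>, where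
  \<open>P = (A - s)\<^sup>2 + t\<^sup>2\<close> is coercive.\<close>

lemma not_in_op_spectrumI:
  fixes A :: "'a::{real_inner, complete_space} \<Rightarrow>\<^sub>L 'a"
  assumes sa: "selfadjoint_op A" and c: "c > 0"
    and lower: "\<And>x. c * (norm x)\<^sup>2 \<le> (norm (A x - Re z *\<^sub>R x))\<^sup>2 + (Im z)\<^sup>2 * (norm x)\<^sup>2"
  shows "z \<notin> op_spectrum A"
proof -
  define s t where "s = Re z" and "t = Im z"
  define N where "N = A - s *\<^sub>R id_blinfun"
  have N: "N x = A x - s *\<^sub>R x" for x
    by (simp add: N_def blinfun.bilinear_simps)
  have Nsa: "N x \<bullet> y = x \<bullet> N y" for x y
    using sa by (simp add: N selfadjoint_op_def inner_diff_left inner_diff_right)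
  define P where "P = (N o\<^sub>L N) + t\<^sup>2 *\<^sub>R id_blinfun"
  have P: "P x = N (N x) + t\<^sup>2 *\<^sub>R x" for x
    by (simp add: P_def blinfun.bilinear_simps)
  \<comment> \<open>The quadratic form of \<open>P\<close> is the right-hand side of
    \<open>lower\<close>, so \<open>lower\<close> says that \<open>P\<close> is coercive.\<close>
  have "P x \<bullet> x = (norm (A x - s *\<^sub>R x))\<^sup>2 + t\<^sup>2 * (norm x)\<^sup>2" for x
    using Nsa[of "N x" x] by (simp add: P inner_add_left flip: N dot_square_norm)
  then have "coercive_op P"
    using c lower by (auto simp: coercive_op_def s_def t_def)
  then obtain R where RP: "R o\<^sub>L P = id_blinfun" "P o\<^sub>L R = id_blinfun"
    by (rule coercive_op_invertible)
  have R1: "R (P x) = x" and R2: "P (R x) = x" for x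
    using arg_cong[OF RP(1), of "\<lambda>B. B x"] arg_cong[OF RP(2), of "\<lambda>B. B x"] by simp_all
  have "P (N x) = N (P x)" for x
    by (simp add: P blinfun.bilinear_simps)
  then have NR: "N (R x) = R (N x)" for x
    by (metis R1 R2)
  have R3: "R (N (N x)) = x - t\<^sup>2 *\<^sub>R R x" for x
    using R1[of x] by (simp add: P blinfun.bilinear_simps algebra_simps)
  \<comment> \<open>In real blocks, \<open>Q\<close> is \<open>(N + i t) R\<close> and
    \<open>L\<close> below is \<open>N - i t\<close>; their product in either order is
    \<open>P R = id\<close>, since \<open>N\<close> commutes with \<open>R\<close>.\<close>
  define Q where "Q = block_op (N o\<^sub>L R) (- t *\<^sub>R R) (t *\<^sub>R R) (N o\<^sub>L R)"
  define L where "L = complexify A - complex_scalar z"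
  have L: "L p = (N (fst p) + t *\<^sub>R snd p, N (snd p) - t *\<^sub>R fst p)" for p
    by (simp add: complexify_apply complex_scalar_apply blinfun.bilinear_simps N s_def t_def L_def)
  have "complex_linear_op Q"
    unfolding complex_linear_op_def
    by (auto intro!: blinfun_eqI
        simp: Q_def complex_scalar_apply blinfun.bilinear_simps algebra_simps)
  moreover have "Q o\<^sub>L L = id_blinfun"
    by (rule blinfun_eqI) (auto simp: L Q_def NR R3 blinfun.bilinear_simps power2_eq_square)
  moreover have "L o\<^sub>L Q = id_blinfun"
    by (rule blinfun_eqI)
      (auto simp: L Q_def NR R3 blinfun.bilinear_simps power2_eq_square algebra_simps)
  ultimately show ?thesis by (auto simp: op_spectrum_def L_def)
qed

text \<open>A bounded left inverse \<open>R\<close> of \<open>A - l\<close> would give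
  \<open>norm x \<le> norm R * norm (A x - l x)\<close>, tested on real vectors
  \<open>(x, 0)\<close>. The strict inequality excludes \<open>x = 0\<close>.\<close>

lemma in_op_spectrumI:
  fixes A :: "'a::real_normed_vector \<Rightarrow>\<^sub>L 'a"
  assumes "\<And>e. e > 0 \<Longrightarrow> \<exists>x. norm (A x - l *\<^sub>R x) < e * norm x"
  shows "complex_of_real l \<in> op_spectrum A"
proof (rule ccontr)
  let ?L = "complexify A - complex_scalar (complex_of_real l)"
  assume "complex_of_real l \<notin> op_spectrum A"
  then obtain R where "R o\<^sub>L ?L = id_blinfun" by (auto simp: op_spectrum_def)
  then have RL: "R (?L p) = p" for p
    by (metis blinfun_apply_blinfun_compose blinfun_apply_id_blinfun)
  define e where "e = 1 / (norm R + 1)"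
  have pos: "norm R + 1 > 0" by (simp add: add_nonneg_pos)
  then have "e > 0" by (simp add: e_def)
  then obtain x where x: "norm (A x - l *\<^sub>R x) < e * norm x" using assms by blast
  have "?L (x, 0) = (A x - l *\<^sub>R x, 0)"
    by (simp add: complexify_apply complex_scalar_apply blinfun.bilinear_simps)
  then have "R (A x - l *\<^sub>R x, 0) = (x, 0)" by (metis RL)
  then have "norm x \<le> norm R * norm (A x - l *\<^sub>R x)"
    using norm_blinfun[of R "(A x - l *\<^sub>R x, 0)"] by (simp add: norm_Pair)
  also have "\<dots> \<le> (norm R + 1) * norm (A x - l *\<^sub>R x)"
    by (simp add: mult_right_mono)
  also have "\<dots> < (norm R + 1) * (e * norm x)"
    using x pos by (simp add: mult_strict_left_mono)
  also have "\<dots> = norm x" using pos by (simp add: e_def)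
  finally show False by simp
qed

text \<open>A positive semidefinite form satisfies the Cauchy--Schwarz inequality; the second
  argument is taken to be \<open>A x\<close>.\<close>

lemma nonneg_op_norm_le:
  fixes A :: "'a::real_inner \<Rightarrow>\<^sub>L 'a"
  assumes sa: "selfadjoint_op A" and nn: "\<And>x. 0 \<le> A x \<bullet> x"
    and bpos: "b > 0" and b: "\<And>x. A x \<bullet> x \<le> b * (norm x)\<^sup>2"
  shows "(norm (A x))\<^sup>2 \<le> b * (A x \<bullet> x)"
proof -
  define u v where "u = A x \<bullet> x" and "v = (norm (A x))\<^sup>2"
  have q: "0 \<le> u - 2 * r * v + r\<^sup>2 * (b * v)" for r
  proof -
    have "0 \<le> A (x - r *\<^sub>R A x) \<bullet> (x - r *\<^sub>R A x)" by (rule nn)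
    also have "\<dots> = u - 2 * r * v + r\<^sup>2 * (A (A x) \<bullet> A x)"
      using sa unfolding selfadjoint_op_def
      by (simp add: u_def v_def power2_norm_eq_inner power2_eq_square[of r] blinfun.bilinear_simps
          inner_diff_left inner_diff_right inner_commute algebra_simps)
    also have "\<dots> \<le> u - 2 * r * v + r\<^sup>2 * (b * v)"
      using b[of "A x"] by (simp add: v_def mult_left_mono)
    finally show ?thesis .
  qed
  \<comment> \<open>The value \<open>r = 1 / b\<close> minimises the quadratic in
    \<open>r\<close>.\<close>
  have "v \<le> b * u"
    using q[of "1 / b"] bpos by (simp add: field_simps power2_eq_square)
  then show ?thesis by (simp add: u_def v_def)
qed

section \<open>Numerical range and spectrum\<close>

lemma numerical_range_bdd:
  fixes A :: "'a::real_inner \<Rightarrow>\<^sub>L 'a"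
  shows "\<bar>A x \<bullet> x\<bar> \<le> norm A * (norm x)\<^sup>2"
proof -
  have "\<bar>A x \<bullet> x\<bar> \<le> norm (A x) * norm x" by (rule Cauchy_Schwarz_ineq2)
  also have "\<dots> \<le> norm A * norm x * norm x" by (intro mult_right_mono norm_blinfun) simp
  finally show ?thesis by (simp add: power2_eq_square mult.assoc)
qed

text \<open>The operator \<open>P = A - l\<close> is nonnegative, so
  \<open>nonneg_op_norm_le\<close> turns a small value of its form into a small vector
  \<open>P x\<close>. The tolerance \<open>e^2 / b\<close> is what makes \<open>norm (P x)\<close>
  smaller than \<open>e * norm x\<close>.\<close>

lemma inf_numerical_range_approx_eigenvector:
  fixes A :: "'a::real_inner \<Rightarrow>\<^sub>L 'a"
  assumes sa: "selfadjoint_op A" and nn: "\<And>x. l * (norm x)\<^sup>2 \<le> A x \<bullet> x"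
    and inf: "\<And>e. e > 0 \<Longrightarrow> \<exists>x. A x \<bullet> x < (l + e) * (norm x)\<^sup>2"
    and "e > 0"
  shows "\<exists>x. norm (A x - l *\<^sub>R x) < e * norm x"
proof -
  define P where "P = A - l *\<^sub>R id_blinfun"
  define b where "b = norm P + 1"
  have P: "P x = A x - l *\<^sub>R x" for x by (simp add: P_def blinfun.bilinear_simps)
  have Pi: "P x \<bullet> x = A x \<bullet> x - l * (norm x)\<^sup>2" for x
    by (simp add: P inner_diff_left dot_square_norm)
  have b: "b > 0" by (simp add: b_def add_nonneg_pos)
  have "P x \<bullet> x \<le> b * (norm x)\<^sup>2" for x
  proof -
    have "norm P * (norm x)\<^sup>2 \<le> b * (norm x)\<^sup>2"
      by (simp add: b_def mult_right_mono)
    then show ?thesis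
      using numerical_range_bdd[of P x] by linarith
  qed
  moreover have "selfadjoint_op P"
    using sa by (simp add: selfadjoint_op_def P inner_diff_left inner_diff_right)
  ultimately have CS: "(norm (P x))\<^sup>2 \<le> b * (P x \<bullet> x)" for x
    using nonneg_op_norm_le[of P b] nn b by (simp add: Pi)
  have "e\<^sup>2 / b > 0" using b \<open>e > 0\<close> by simp
  then obtain x where "A x \<bullet> x < (l + e\<^sup>2 / b) * (norm x)\<^sup>2" using inf by blast
  then have "P x \<bullet> x < e\<^sup>2 / b * (norm x)\<^sup>2"
    by (simp add: Pi algebra_simps)
  then have "b * (P x \<bullet> x) < b * (e\<^sup>2 / b * (norm x)\<^sup>2)"
    using b by (rule mult_strict_left_mono)
  also have "\<dots> = (e * norm x)\<^sup>2" using b by (simp add: power_mult_distrib)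
  finally have "(norm (P x))\<^sup>2 < (e * norm x)\<^sup>2" using CS[of x] by linarith
  then have "norm (P x) < e * norm x"
    using \<open>e > 0\<close> by (intro power2_less_imp_less[of _ "e * norm x"]) auto
  then show "\<exists>x. norm (A x - l *\<^sub>R x) < e * norm x" by (auto simp: P)
qed

text \<open>The number \<open>l\<close> is the infimum of the Rayleigh quotients, a nonempty set by
  \<open>nontriv\<close>. Approximate eigenvectors are kept in the conclusion so that the supremum
  can be treated by passing to \<open>- A\<close>.\<close>

lemma inf_numerical_range_approx_spectrum:
  fixes A :: "'a::real_inner \<Rightarrow>\<^sub>L 'a"
  assumes sa: "selfadjoint_op A" and nontriv: "w \<noteq> (0::'a)"
  obtains l where "\<And>e. e > 0 \<Longrightarrow> \<exists>x. norm (A x - l *\<^sub>R x) < e * norm x"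
    "\<And>x. l * (norm x)\<^sup>2 \<le> A x \<bullet> x"
proof -
  define W where "W = {(A x \<bullet> x) / (norm x)\<^sup>2 |x. x \<noteq> 0}"
  define l where "l = Inf W"
  have ne: "W \<noteq> {}" using nontriv by (auto simp: W_def)
  have "bdd_below W"
  proof (rule bdd_belowI)
    fix y assume "y \<in> W"
    then obtain x where x: "x \<noteq> 0" "y = (A x \<bullet> x) / (norm x)\<^sup>2" by (auto simp: W_def)
    have "- norm A * (norm x)\<^sup>2 \<le> A x \<bullet> x"
      using numerical_range_bdd[of A x] by linarith
    then show "- norm A \<le> y" using x by (simp add: pos_le_divide_eq)
  qed
  then have "l \<le> (A x \<bullet> x) / (norm x)\<^sup>2" if "x \<noteq> 0" for x
    using that unfolding l_def by (intro cInf_lower) (auto simp: W_def)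
  then have low: "l * (norm x)\<^sup>2 \<le> A x \<bullet> x" for x
    by (cases "x = 0") (auto simp: pos_le_divide_eq)
  moreover have "\<exists>x. A x \<bullet> x < (l + e) * (norm x)\<^sup>2" if "e > 0" for e
  proof -
    obtain y where "y \<in> W" "y < l + e"
      using cInf_lessD[OF ne, of "l + e"] \<open>e > 0\<close> by (auto simp: l_def)
    then obtain x where "x \<noteq> 0" "(A x \<bullet> x) / (norm x)\<^sup>2 < l + e" by (auto simp: W_def)
    then show ?thesis by (auto simp: pos_divide_less_eq)
  qed
  ultimately show thesis
    using that inf_numerical_range_approx_eigenvector[OF sa low] by metis
qed

lemma inf_numerical_range_in_op_spectrum:
  fixes A :: "'a::real_inner \<Rightarrow>\<^sub>L 'a"
  assumes sa: "selfadjoint_op A" and nontriv: "w \<noteq> (0::'a)"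
  obtains l where "complex_of_real l \<in> op_spectrum A" "\<And>x. l * (norm x)\<^sup>2 \<le> A x \<bullet> x"
  using inf_numerical_range_approx_spectrum[OF assms] in_op_spectrumI by metis

lemma sup_numerical_range_in_op_spectrum:
  fixes A :: "'a::real_inner \<Rightarrow>\<^sub>L 'a"
  assumes sa: "selfadjoint_op A" and nontriv: "w \<noteq> (0::'a)"
  obtains l where "complex_of_real l \<in> op_spectrum A" "\<And>x. A x \<bullet> x \<le> l * (norm x)\<^sup>2"
proof -
  have "selfadjoint_op (- A)"
    using sa by (simp add: selfadjoint_op_def blinfun.bilinear_simps)
  from inf_numerical_range_approx_spectrum[OF this nontriv] obtain l
    where l: "\<And>e. e > 0 \<Longrightarrow> \<exists>x. norm ((- A) x - l *\<^sub>R x) < e * norm x"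
      "\<And>x. l * (norm x)\<^sup>2 \<le> (- A) x \<bullet> x"
    by blast
  have "complex_of_real (- l) \<in> op_spectrum A"
  proof (rule in_op_spectrumI)
    fix e :: real assume "e > 0"
    then obtain x where "norm ((- A) x - l *\<^sub>R x) < e * norm x" using l(1) by blast
    moreover have "(- A) x - l *\<^sub>R x = - (A x - (- l) *\<^sub>R x)"
      by (simp add: blinfun.bilinear_simps)
    ultimately show "\<exists>x. norm (A x - (- l) *\<^sub>R x) < e * norm x"
      by (metis norm_minus_cancel)
  qed
  moreover have "A x \<bullet> x \<le> - l * (norm x)\<^sup>2" for x
    using l(2)[of x] by (simp add: blinfun.bilinear_simps)
  ultimately show thesis by (rule that)
qed

text \<open>Forwards, the infimum of the numerical range is a spectral value, hence positive, and
  serves as coercivity constant. Backwards, a point off the positive axis has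
  \<open>Im z \<noteq> 0\<close> or \<open>Re z \<le> 0\<close>; in the second case coercivity and
  Cauchy-Schwarz bound \<open>A - Re z\<close> from below.\<close>

lemma positive_invertible_iff:
  fixes A :: "'a::{real_inner, complete_space} \<Rightarrow>\<^sub>L 'a"
  shows "positive_invertible A \<longleftrightarrow> selfadjoint_op A \<and> coercive_op A"
proof (intro iffI conjI)
  assume pos: "positive_invertible A"
  then show sa: "selfadjoint_op A" by (simp add: positive_invertible_def)
  show "coercive_op A"
  proof (cases "\<exists>w::'a. w \<noteq> 0")
    case True
    then obtain l where l: "complex_of_real l \<in> op_spectrum A" "\<And>x. l * (norm x)\<^sup>2 \<le> A x \<bullet> x"
      using inf_numerical_range_in_op_spectrum[OF sa] by blast
    then have "l > 0" using pos by (auto simp: positive_invertible_def)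
    with l(2) show ?thesis by (auto simp: coercive_op_def)
  next
    case False
    then have "x = 0" for x :: 'a by blast
    then have "1 * (norm x)\<^sup>2 \<le> A x \<bullet> x" for x by (metis blinfun.zero_right inner_zero_left
          mult_zero_right norm_zero order_refl zero_power2)
    then show ?thesis unfolding coercive_op_def by (metis zero_less_one)
  qed
next
  assume "selfadjoint_op A \<and> coercive_op A"
  then obtain c where sa: "selfadjoint_op A" and c: "c > 0" "\<And>x. c * (norm x)\<^sup>2 \<le> A x \<bullet> x"
    by (auto simp: coercive_op_def)
  have "z \<in> complex_of_real ` {0<..}" if z: "z \<in> op_spectrum A" for z
  proof (rule ccontr)
    assume "z \<notin> complex_of_real ` {0<..}"
    moreover have "z = complex_of_real (Re z)" if "Im z = 0" using that by (simp add: complex_eq_iff)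
    ultimately consider "Im z \<noteq> 0" | "Re z \<le> 0" by force
    then show False
    proof cases
      case 1
      then show ?thesis
        using not_in_op_spectrumI[OF sa, of "(Im z)\<^sup>2" z] z by simp
    next
      case 2
      have "c\<^sup>2 * (norm x)\<^sup>2 \<le> (norm (A x - Re z *\<^sub>R x))\<^sup>2 + (Im z)\<^sup>2 * (norm x)\<^sup>2" for x
      proof -
        have "c * norm x * norm x \<le> (A x - Re z *\<^sub>R x) \<bullet> x"
          using c(2)[of x] 2 mult_nonpos_nonneg[of "Re z" "x \<bullet> x"]
          by (simp add: inner_diff_left power2_eq_square)
        also have "\<dots> \<le> norm (A x - Re z *\<^sub>R x) * norm x" by (rule norm_cauchy_schwarz)
        finally have "c * norm x \<le> norm (A x - Re z *\<^sub>R x)" by (cases "x = 0") auto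
        then have "(c * norm x)\<^sup>2 \<le> (norm (A x - Re z *\<^sub>R x))\<^sup>2"
          using c(1) by (intro power_mono) auto
        then show ?thesis by (simp add: power_mult_distrib add_increasing2)
      qed
      then show ?thesis
        using not_in_op_spectrumI[OF sa, of "c\<^sup>2" z] z c(1) by simp
    qed
  qed
  with sa show "positive_invertible A" by (auto simp: positive_invertible_def)
qed

text \<open>The extremes \<open>a\<close> and \<open>b\<close> of the numerical range lie in the
  spectrum, hence between its infimum and supremum. Boundedness of the spectrum is shown first, to
  give \<open>Inf\<close> and \<open>Sup\<close> their meaning.\<close>

lemma op_spectrum_norm_bounds:
  fixes T :: "'a::{real_inner, complete_space} \<Rightarrow>\<^sub>L 'a"
  assumes pos: "positive_invertible T"
  shows "Inf (Re ` op_spectrum T) * norm v \<le> norm (T v)" (is ?lower)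
    and "norm (T v) \<le> Sup (Re ` op_spectrum T) * norm v" (is ?upper)
proof -
  have sa: "selfadjoint_op T" and sub: "op_spectrum T \<subseteq> complex_of_real ` {0<..}"
    using pos by (auto simp: positive_invertible_def)
  have below: "bdd_below (Re ` op_spectrum T)"
    using sub by (intro bdd_belowI[of _ 0]) force
  have above: "bdd_above (Re ` op_spectrum T)"
  proof (rule bdd_aboveI)
    fix l assume "l \<in> Re ` op_spectrum T"
    then have l: "l > 0" "complex_of_real l \<in> op_spectrum T" using sub by auto
    show "l \<le> norm T"
    proof (rule ccontr)
      assume "\<not> l \<le> norm T"
      then have gt: "l - norm T > 0" by simp
      have "(l - norm T)\<^sup>2 * (norm x)\<^sup>2 \<le> (norm (T x - l *\<^sub>R x))\<^sup>2" for x
      proof -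
        have "(l - norm T) * norm x \<le> norm (l *\<^sub>R x) - norm (T x)"
          using norm_blinfun[of T x] l(1) by (simp add: algebra_simps)
        also have "\<dots> \<le> norm (T x - l *\<^sub>R x)"
          by (metis norm_minus_commute norm_triangle_ineq2)
        finally have "((l - norm T) * norm x)\<^sup>2 \<le> (norm (T x - l *\<^sub>R x))\<^sup>2"
          using gt by (intro power_mono) auto
        then show ?thesis by (simp add: power_mult_distrib)
      qed
      then show False
        using not_in_op_spectrumI[OF sa, of "(l - norm T)\<^sup>2" "complex_of_real l"] gt l(2) by simp
    qed
  qed
  have "?lower \<and> ?upper"
  proof (cases "v = 0")
    case False
    obtain a where a: "complex_of_real a \<in> op_spectrum T" "\<And>x. a * (norm x)\<^sup>2 \<le> T x \<bullet> x"
      using inf_numerical_range_in_op_spectrum[OF sa False] by blast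
    obtain b where b: "complex_of_real b \<in> op_spectrum T" "\<And>x. T x \<bullet> x \<le> b * (norm x)\<^sup>2"
      using sup_numerical_range_in_op_spectrum[OF sa False] by blast
    have ab: "a > 0" "b > 0" using a(1) b(1) sub by auto
    have "Inf (Re ` op_spectrum T) \<le> a"
      using below a(1) by (intro cInf_lower) force+
    moreover have "a * norm v \<le> norm (T v)"
    proof -
      have "a * norm v * norm v \<le> norm (T v) * norm v"
        using a(2)[of v] norm_cauchy_schwarz[of "T v" v] by (simp add: power2_eq_square)
      then show ?thesis using False by simp
    qed
    ultimately have ?lower by (meson mult_right_mono norm_ge_zero order_trans)
    have nn: "0 \<le> T x \<bullet> x" for x
      using a(2)[of x] ab by (meson less_imp_le mult_nonneg_nonneg order_trans zero_le_power2)
    have "(norm (T v))\<^sup>2 \<le> b * (T v \<bullet> v)"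
      by (rule nonneg_op_norm_le[OF sa nn ab(2) b(2)])
    also have "\<dots> \<le> b * (b * (norm v)\<^sup>2)"
      using b(2)[of v] ab by simp
    also have "\<dots> = (b * norm v)\<^sup>2" by (simp add: power2_eq_square)
    finally have "norm (T v) \<le> b * norm v"
      by (rule power2_le_imp_le) (use ab in simp)
    moreover have "b \<le> Sup (Re ` op_spectrum T)"
      using above b(1) by (intro cSup_upper) force+
    ultimately have ?upper by (meson mult_right_mono norm_ge_zero order_trans)
    with \<open>?lower\<close> show ?thesis by blast
  qed simp
  then show ?lower ?upper by auto
qed

text \<open>Converse to \<open>in_op_spectrumI\<close> for self-adjoint operators: without
  approximate eigenvectors, \<open>A - l\<close> is bounded below and
  \<open>not_in_op_spectrumI\<close> applies.\<close>

lemma op_spectrum_approx_eigenvector: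
  fixes A :: "'a::{real_inner, complete_space} \<Rightarrow>\<^sub>L 'a"
  assumes "selfadjoint_op A" "complex_of_real l \<in> op_spectrum A" "e > 0"
  obtains x where "norm (A x - l *\<^sub>R x) < e * norm x"
proof -
  have "\<exists>x. norm (A x - l *\<^sub>R x) < e * norm x"
  proof (rule ccontr)
    assume "\<not> (\<exists>x. norm (A x - l *\<^sub>R x) < e * norm x)"
    then have "(e * norm x)\<^sup>2 \<le> (norm (A x - l *\<^sub>R x))\<^sup>2" for x
      using \<open>e > 0\<close> by (intro power_mono) (auto simp: not_less)
    then show False
      using not_in_op_spectrumI[OF assms(1), of "e\<^sup>2" "complex_of_real l"] assms(2,3)
      by (simp add: power_mult_distrib)
  qed
  with that show thesis by blast
qed

subsection \<open>Williamson normal forms\<close>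

lemma norm_sympl_J [simp]: "norm (sympl_J p) = norm p"
  by (simp add: sympl_J_def blinfun.bilinear_simps norm_prod_def)

text \<open>The identity \<open>T Q\<^sup>-\<^sup>1 = J Q\<^sup>-\<^sup>1 J\<^sup>-\<^sup>1 (D \<oplus> D)\<close> turns an approximate eigenvector \<open>x\<close> of \<open>D\<close> for
  \<open>l\<close> into vectors \<open>p\<close>, \<open>q\<close> with \<open>T p\<close> close to \<open>l J q\<close> and \<open>T q\<close> close to \<open>- l J p\<close>; as \<open>J\<close>
  is isometric, \<open>l\<close> lies between the lower and the upper norm bound of \<open>T\<close>.\<close>

lemma williamson_form_op_spectrum_bounds:
  fixes T :: "('a::{real_inner, complete_space} \<times> 'a) \<Rightarrow>\<^sub>L ('a \<times> 'a)"
  assumes form: "williamson_form T D"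
    and m: "\<And>v. m * norm v \<le> norm (T v)" and M: "\<And>v. norm (T v) \<le> M * norm v"
  shows "op_spectrum D \<subseteq> complex_of_real ` {m..M}"
proof
  fix z assume z: "z \<in> op_spectrum D"
  have sa: "selfadjoint_op D" and "op_spectrum D \<subseteq> complex_of_real ` {0<..}"
    using form by (auto simp: williamson_form_def positive_invertible_def)
  then obtain l where l: "z = complex_of_real l" "l > 0" using z by blast
  obtain Q where Q: "symplectic Q" "T = adj_op Q o\<^sub>L block_op D 0 0 D o\<^sub>L Q"
    using form by (auto simp: williamson_form_def)
  obtain R where "Q o\<^sub>L R = id_blinfun"
    using Q(1) by (auto simp: symplectic_def invertible_op_def)
  then have QR: "Q (R y) = y" for y
    by (metis blinfun_apply_blinfun_compose blinfun_apply_id_blinfun)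
  have "adj_op Q (sympl_J (Q y)) = sympl_J y" for y
    using Q(1) unfolding symplectic_def by (metis blinfun_apply_blinfun_compose)
  \<comment> \<open>Substituting \<open>R y\<close> in \<open>Q^T J Q = J\<close> gives
    \<open>Q^T J = J R\<close>. Below it is used with \<open>(y, 0) = J (0, y)\<close> and
    \<open>(0, y) = - J (y, 0)\<close>.\<close>
  then have adjJ: "adj_op Q (sympl_J y) = sympl_J (R y)" for y
    by (metis QR)
  have TR1: "T (R (x, 0)) = sympl_J (R (0, D x))" for x
    by (simp add: Q(2) QR flip: adjJ) (simp add: sympl_J_def)
  have TR2: "T (R (0, x)) = - sympl_J (R (D x, 0))" for x
    by (simp add: Q(2) QR flip: adjJ blinfun.minus_right)
      (simp add: sympl_J_def blinfun.bilinear_simps)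
  have approx: "m \<le> l + d \<and> l \<le> M + d" if "d > 0" for d
  proof -
    \<comment> \<open>The error is at most \<open>norm R * e * norm x\<close>, and
      \<open>norm x \<le> norm Q * norm p\<close>, likewise for \<open>q\<close>. This
      \<open>e\<close> makes it at most \<open>d * norm p\<close> or
      \<open>d * norm q\<close>.\<close>
    define e where "e = d / (norm R * norm Q + 1)"
    have pos: "norm R * norm Q + 1 > 0" by (simp add: add_nonneg_pos)
    have e: "e > 0" using pos that by (simp add: e_def)
    have ed: "norm R * norm Q * e \<le> d"
      using pos that by (simp add: e_def field_simps)
    obtain x where x: "norm (D x - l *\<^sub>R x) < e * norm x"
      using op_spectrum_approx_eigenvector[OF sa _ e] z l by blast
    then have "x \<noteq> 0" by auto
    define p q where "p = R (x, 0)" and "q = R (0, x)"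
    have "p \<noteq> 0" using QR[of "(x, 0)"] \<open>x \<noteq> 0\<close>
      by (metis blinfun.zero_right fst_conv fst_zero p_def)
    have err: "norm (R w) \<le> d * norm y"
      if "norm w = norm (D x - l *\<^sub>R x)" "norm (Q y) = norm x" for w y
    proof -
      have "norm (R w) \<le> norm R * (e * norm x)"
        using order_trans[OF norm_blinfun[of R w]] that(1) x by (simp add: mult_left_mono)
      also have "\<dots> \<le> norm R * (e * (norm Q * norm y))"
        using norm_blinfun[of Q y] that(2) e by (intro mult_left_mono) auto
      also have "\<dots> = norm R * norm Q * e * norm y" by simp
      also have "\<dots> \<le> d * norm y" using ed by (rule mult_right_mono) simp
      finally show ?thesis .
    qed
    have "(0, D x) = l *\<^sub>R (0, x) + (0, D x - l *\<^sub>R x)" by simp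
    then have "T p = sympl_J (l *\<^sub>R q + R (0, D x - l *\<^sub>R x))"
      unfolding p_def q_def TR1 by (metis blinfun.add_right blinfun.scaleR_right)
    then have Tp: "norm (T p) = norm (l *\<^sub>R q + R (0, D x - l *\<^sub>R x))" by simp
    have "(D x, 0) = l *\<^sub>R (x, 0) + (D x - l *\<^sub>R x, 0)" by simp
    then have "T q = - sympl_J (l *\<^sub>R p + R (D x - l *\<^sub>R x, 0))"
      unfolding p_def q_def TR2 by (metis blinfun.add_right blinfun.scaleR_right)
    then have Tq: "norm (T q) = norm (l *\<^sub>R p + R (D x - l *\<^sub>R x, 0))" by simp
    have e1: "norm (R (0, D x - l *\<^sub>R x)) \<le> d * norm p"
      by (rule err) (simp_all add: norm_Pair p_def QR)
    have e2: "norm (R (D x - l *\<^sub>R x, 0)) \<le> d * norm q"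
      by (rule err) (simp_all add: norm_Pair q_def QR)
    have bp: "norm (T p) \<le> l * norm q + d * norm p" "l * norm q \<le> norm (T p) + d * norm p"
      using norm_triangle_ineq[of "l *\<^sub>R q" "R (0, D x - l *\<^sub>R x)"]
        norm_diff_ineq[of "l *\<^sub>R q" "R (0, D x - l *\<^sub>R x)"] e1 l(2) by (auto simp: Tp)
    have bq: "norm (T q) \<le> l * norm p + d * norm q" "l * norm p \<le> norm (T q) + d * norm q"
      using norm_triangle_ineq[of "l *\<^sub>R p" "R (D x - l *\<^sub>R x, 0)"]
        norm_diff_ineq[of "l *\<^sub>R p" "R (D x - l *\<^sub>R x, 0)"] e2 l(2) by (auto simp: Tq)
    \<comment> \<open>Each single estimate compares \<open>p\<close> with \<open>q\<close>; in the
      sum of the two the common factor \<open>norm p + norm q\<close> appears and cancels.\<close>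
    have "m * (norm p + norm q) \<le> (l + d) * (norm p + norm q)"
      using bp(1) bq(1) m[of p] m[of q] by (simp add: algebra_simps)
    moreover have "l * (norm p + norm q) \<le> (M + d) * (norm p + norm q)"
      using bp(2) bq(2) M[of p] M[of q] by (simp add: algebra_simps)
    moreover have "norm p + norm q > 0" using \<open>p \<noteq> 0\<close> by (simp add: add_pos_nonneg)
    ultimately show ?thesis by (metis mult_le_cancel_right_pos)
  qed
  have "m \<le> l" "l \<le> M" using approx by (auto intro: field_le_epsilon)
  then show "z \<in> complex_of_real ` {m..M}" using l(1) by simp
qed

section \<open>Existence of Williamson forms in both classes\<close>

lemma adj_op_eqI:
  fixes A :: "'a::real_inner \<Rightarrow>\<^sub>L 'b::real_inner" and B :: "'b \<Rightarrow>\<^sub>L 'a"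
  assumes "\<And>x y. A x \<bullet> y = x \<bullet> B y"
  shows "adj_op A = B"
  unfolding adj_op_def using assms by (simp add: adjoint_unique[of A B] blinfun_apply_inverse)

text \<open>An explicit transpose \<open>Q'\<close> determines \<open>adj_op Q\<close> by uniqueness
  of adjoints, so only identities between block operators remain to be checked.\<close>

lemma williamson_formI:
  fixes D :: "'a::real_inner \<Rightarrow>\<^sub>L 'a" and Q Q' :: "('a \<times> 'a) \<Rightarrow>\<^sub>L ('a \<times> 'a)"
  assumes "positive_invertible D" "\<And>x y. Q x \<bullet> y = x \<bullet> Q' y"
    "Q' o\<^sub>L sympl_J o\<^sub>L Q = sympl_J" "R o\<^sub>L Q = id_blinfun" "Q o\<^sub>L R = id_blinfun"
    "T = Q' o\<^sub>L block_op D 0 0 D o\<^sub>L Q"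
  shows "williamson_form T D"
  using assms adj_op_eqI[of Q Q']
  by (auto simp: williamson_form_def symplectic_def invertible_op_def)

text \<open>With \<open>a = A\<^sup>1\<^sup>/\<^sup>4\<close> and \<open>b = B\<^sup>1\<^sup>/\<^sup>4\<close>, take \<open>D = a\<^sup>2 b\<^sup>2\<close> and \<open>S = a b\<^sup>-\<^sup>1\<close>.\<close>

lemma commuting_simultaneous_congruence:
  fixes A B :: "'a::{real_inner, complete_space} \<Rightarrow>\<^sub>L 'a"
  assumes A: "positive_invertible A" and B: "positive_invertible B" and AB: "A o\<^sub>L B = B o\<^sub>L A"
  obtains D S S' :: "'a \<Rightarrow>\<^sub>L 'a" where "positive_invertible D"
    "\<And>x. S (D (S x)) = A x" "\<And>x. S' (D (S' x)) = B x"
    "\<And>x y. S x \<bullet> y = x \<bullet> S y" "\<And>x y. S' x \<bullet> y = x \<bullet> S' y"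
    "\<And>x. S (S' x) = x" "\<And>x. S' (S x) = x"
proof -
  have root: "\<exists>R. selfadjoint_op R \<and> coercive_op R \<and> (\<forall>x. R (R (R (R x))) = C x) \<and>
      (\<forall>E. commuting_op E C \<longrightarrow> commuting_op E R)"
    if pos: "positive_invertible C" for C :: "'a \<Rightarrow>\<^sub>L 'a"
  proof -
    have C: "selfadjoint_op C" "coercive_op C"
      using pos by (simp_all add: positive_invertible_iff)
    obtain P where P: "selfadjoint_op P" "coercive_op P" "P o\<^sub>L P = C"
      "\<And>E. commuting_op E C \<Longrightarrow> commuting_op E P"
      by (rule sqrt_op[OF C], rule that)
    obtain R where R: "selfadjoint_op R" "coercive_op R" "R o\<^sub>L R = P"
      "\<And>E. commuting_op E P \<Longrightarrow> commuting_op E R"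
      by (rule sqrt_op[OF P(1,2)], rule that)
    have "R (R (R (R x))) = C x" for x
      using R(3) P(3) by (metis blinfun_apply_blinfun_compose)
    with R P(4) show ?thesis by blast
  qed
  obtain a where a: "selfadjoint_op a" "coercive_op a" "\<And>x. a (a (a (a x))) = A x"
    "\<And>E. commuting_op E A \<Longrightarrow> commuting_op E a"
    using root[OF A] by blast
  obtain b where b: "selfadjoint_op b" "coercive_op b" "\<And>x. b (b (b (b x))) = B x"
    "\<And>E. commuting_op E B \<Longrightarrow> commuting_op E b"
    using root[OF B] by blast
  have "commuting_op B A"
    using AB by (metis blinfun_apply_blinfun_compose commuting_op_def)
  \<comment> \<open>The bicommutant property is used twice: \<open>B\<close> commutes with
    \<open>A\<close>, hence with \<open>a\<close>; so \<open>a\<close> commutes with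
    \<open>B\<close>, hence with \<open>b\<close>.\<close>
  then have "commuting_op a B" using a(4) by (simp add: commuting_op_def)
  then have ba: "b (a x) = a (b x)" for x using b(4) by (simp add: commuting_op_def)
  obtain a' where "a' o\<^sub>L a = id_blinfun" "a o\<^sub>L a' = id_blinfun"
    using coercive_op_invertible[OF a(2)] .
  then have a'a: "a' (a x) = x" and aa': "a (a' x) = x" for x
    by (metis blinfun_apply_blinfun_compose blinfun_apply_id_blinfun)+
  obtain b' where "b' o\<^sub>L b = id_blinfun" "b o\<^sub>L b' = id_blinfun"
    using coercive_op_invertible[OF b(2)] .
  then have b'b: "b' (b x) = x" and bb': "b (b' x) = x" for x
    by (metis blinfun_apply_blinfun_compose blinfun_apply_id_blinfun)+
  have b'a: "b' (a x) = a (b' x)" for x by (metis ba b'b bb')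
  have ba': "b (a' x) = a' (b x)" for x by (metis ba a'a aa')
  have b'a': "b' (a' x) = a' (b' x)" for x by (metis b'a a'a aa')
  \<comment> \<open>As rewrite rules these move \<open>a\<close> and its inverse to the left of
    \<open>b\<close> and its inverse, and cancel inverse pairs.\<close>
  note comm = ba b'a ba' b'a' a'a aa' b'b bb'
  have sa: "a x \<bullet> y = x \<bullet> a y" and sb: "b x \<bullet> y = x \<bullet> b y" for x y
    using a(1) b(1) by (auto simp: selfadjoint_op_def)
  have sa': "a' x \<bullet> y = x \<bullet> a' y" and sb': "b' x \<bullet> y = x \<bullet> b' y" for x y
    by (metis sa aa', metis sb bb')
  define D where "D = a o\<^sub>L a o\<^sub>L b o\<^sub>L b"
  have "selfadjoint_op D"
    by (simp add: selfadjoint_op_def D_def sa sb comm)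
  \<comment> \<open>By commutation \<open>D\<close> is the square of the self-adjoint product
    \<open>a b\<close>, so its form is the squared norm of \<open>a (b x)\<close>.\<close>
  moreover have "coercive_op D"
  proof -
    obtain c where c: "c > 0" "\<And>x. c * norm x \<le> norm (a x)"
      using coercive_op_lower_bound[OF a(2)] by blast
    obtain d where d: "d > 0" "\<And>x. d * norm x \<le> norm (b x)"
      using coercive_op_lower_bound[OF b(2)] by blast
    have "(c * d)\<^sup>2 * (norm x)\<^sup>2 \<le> D x \<bullet> x" for x
    proof -
      have "c * (d * norm x) \<le> c * norm (b x)" using c(1) d(2) by simp
      then have "c * d * norm x \<le> norm (a (b x))"
        using c(2)[of "b x"] by (simp add: mult.assoc)
      then have "(c * d * norm x)\<^sup>2 \<le> (norm (a (b x)))\<^sup>2"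
        using c d by (intro power_mono) auto
      also have "\<dots> = D x \<bullet> x"
        by (simp add: D_def power2_norm_eq_inner sa sb comm)
      finally show ?thesis by (simp add: power_mult_distrib)
    qed
    then show ?thesis unfolding coercive_op_def
      using c(1) d(1) by (intro exI[of _ "(c * d)\<^sup>2"]) auto
  qed
  ultimately have "positive_invertible D" by (simp add: positive_invertible_iff)
  then show thesis
  \<comment> \<open>Commuting the factors, \<open>S D S = a^4 = A\<close> and
    \<open>S' D S' = b^4 = B\<close>, where \<open>S'\<close> is the inverse of
    \<open>S\<close>.\<close>
  proof (rule that[of D "a o\<^sub>L b'" "b o\<^sub>L a'"])
    show "(a o\<^sub>L b') x \<bullet> y = x \<bullet> (a o\<^sub>L b') y" "(b o\<^sub>L a') x \<bullet> y = x \<bullet> (b o\<^sub>L a') y" for x y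
      by (simp_all add: sa sb sa' sb' comm)
    show "(a o\<^sub>L b') ((b o\<^sub>L a') x) = x" "(b o\<^sub>L a') ((a o\<^sub>L b') x) = x" for x
      by (simp_all add: comm)
    show "(a o\<^sub>L b') (D ((a o\<^sub>L b') x)) = A x" "(b o\<^sub>L a') (D ((b o\<^sub>L a') x)) = B x" for x
      by (simp_all add: D_def comm flip: a(3) b(3))
  qed
qed

text \<open>For self-adjoint invertible \<open>S\<close>, the diagonal operator with entries
  \<open>S\<close> and its inverse \<open>S'\<close> is self-adjoint and symplectic.\<close>

lemma class_A_williamson_form:
  fixes T :: "('a::{real_inner, complete_space} \<times> 'a) \<Rightarrow>\<^sub>L ('a \<times> 'a)"
  assumes "class_A T"
  obtains D where "williamson_form T D"
proof -
  obtain A B where AB: "positive_invertible A" "positive_invertible B" "A o\<^sub>L B = B o\<^sub>L A"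
    "T = block_op A 0 0 B"
    using assms by (auto simp: class_A_def)
  obtain D S S' :: "'a \<Rightarrow>\<^sub>L 'a" where D: "positive_invertible D"
    and S: "\<And>x. S (D (S x)) = A x" "\<And>x. S' (D (S' x)) = B x"
    "\<And>x y. S x \<bullet> y = x \<bullet> S y" "\<And>x y. S' x \<bullet> y = x \<bullet> S' y"
    "\<And>x. S (S' x) = x" "\<And>x. S' (S x) = x"
    by (rule commuting_simultaneous_congruence[OF AB(1-3)], rule that)
  show thesis
  proof (rule that, rule williamson_formI[OF D])
    show "block_op S 0 0 S' x \<bullet> y = x \<bullet> block_op S 0 0 S' y" for x y
      by (simp add: inner_prod_def S)
    show "block_op S 0 0 S' o\<^sub>L sympl_J o\<^sub>L block_op S 0 0 S' = sympl_J"
      by (rule blinfun_eqI) (simp add: sympl_J_def blinfun.bilinear_simps S)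
    show "block_op S' 0 0 S o\<^sub>L block_op S 0 0 S' = id_blinfun"
      "block_op S 0 0 S' o\<^sub>L block_op S' 0 0 S = id_blinfun"
      by (rule blinfun_eqI, simp add: S)+
    show "T = block_op S 0 0 S' o\<^sub>L block_op D 0 0 D o\<^sub>L block_op S 0 0 S'"
      by (rule blinfun_eqI) (simp add: AB(4) S)
  qed
qed

text \<open>Rotation by 45 degrees is symplectic and transforms class B into class A with
  diagonal blocks \<open>A - B\<close> and \<open>A + B\<close>.\<close>

lemma class_B_williamson_form:
  fixes T :: "('a::{real_inner, complete_space} \<times> 'a) \<Rightarrow>\<^sub>L ('a \<times> 'a)"
  assumes "class_B T"
  obtains D where "williamson_form T D"
proof -
  obtain A B where AB: "positive_invertible (A - B)" "positive_invertible (A + B)"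
    "(A - B) o\<^sub>L (A + B) = (A + B) o\<^sub>L (A - B)" "T = block_op A B B A"
    using assms by (auto simp: class_B_def)
  obtain D S S' :: "'a \<Rightarrow>\<^sub>L 'a" where D: "positive_invertible D"
    and S: "\<And>x. S (D (S x)) = (A - B) x" "\<And>x. S' (D (S' x)) = (A + B) x"
    "\<And>x y. S x \<bullet> y = x \<bullet> S y" "\<And>x y. S' x \<bullet> y = x \<bullet> S' y"
    "\<And>x. S (S' x) = x" "\<And>x. S' (S x) = x"
    by (rule commuting_simultaneous_congruence[OF AB(1-3)], rule that)
  define k :: real where "k = 1 / sqrt 2"
  have k: "k * k = 1 / 2" by (simp add: k_def)
  \<comment> \<open>\<open>Q\<close> is the diagonal operator of \<open>S\<close> and
    \<open>S'\<close> after the rotation with blocks \<open>k (id, - id; id, id)\<close>;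
    \<open>Q'\<close> is its transpose and \<open>R\<close> its inverse.\<close>
  define Q Q' R where "Q = k *\<^sub>R block_op S (- S) S' S'"
    and "Q' = k *\<^sub>R block_op S S' (- S) S'" and "R = k *\<^sub>R block_op S' S (- S') S"
  have half: "(1/2) *\<^sub>R u + (1/2) *\<^sub>R u = u" "(1/2) *\<^sub>R u + ((1/2) *\<^sub>R u + w) = u + w"
    "- ((1/2) *\<^sub>R u) - (1/2) *\<^sub>R u = - u" for u w :: 'a
    by (simp_all flip: scaleR_add_left add.assoc scaleR_minus_left scaleR_diff_left)
  note defs = Q_def Q'_def R_def sympl_J_def blinfun.bilinear_simps
  note alg = k half scaleR_add_right scaleR_diff_right add_ac
  show thesis
  proof (rule that, rule williamson_formI[OF D])
    show "Q x \<bullet> y = x \<bullet> Q' y" for x y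
      by (simp add: defs inner_prod_def S inner_add_left inner_add_right algebra_simps)
    show "Q' o\<^sub>L sympl_J o\<^sub>L Q = sympl_J"
      by (rule blinfun_eqI) (simp add: defs S alg)
    show "R o\<^sub>L Q = id_blinfun" "Q o\<^sub>L R = id_blinfun"
      by (rule blinfun_eqI, simp add: defs S alg prod_eq_iff)+
    show "T = Q' o\<^sub>L block_op D 0 0 D o\<^sub>L Q"
      by (rule blinfun_eqI) (simp add: AB(4) defs S alg)
  qed
qed

text \<open>The sort \<open>{real_inner, polish_space}\<close> encodes a real separable Hilbert
  space.\<close>

theorem theorem10:
  fixes T :: "('a::{real_inner, polish_space} \<times> 'a) \<Rightarrow>\<^sub>L ('a \<times> 'a)"
    and m M :: real
  assumes "positive_invertible T"
    and "class_A T \<or> class_B T"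
    and "m = Inf (Re ` op_spectrum T)"
    and "M = Sup (Re ` op_spectrum T)"
  shows "symplectic_spectrum T \<subseteq> complex_of_real ` {m..M}"
proof -
  \<comment> \<open>Existence makes the choice in \<open>symplectic_spectrum\<close> a genuine
    Williamson form, and the bounds hold for every such form.\<close>
  have "\<exists>D. williamson_form T D"
    using assms(2) class_A_williamson_form class_B_williamson_form by metis
  then have "williamson_form T (SOME D. williamson_form T D)"
    by (rule someI_ex)
  then show ?thesis
    unfolding symplectic_spectrum_def assms(3,4)
    by (rule williamson_form_op_spectrum_bounds) (rule op_spectrum_norm_bounds[OF assms(1)])+
qed

end
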